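(* Let $k(\boldsymbol{x},\boldsymbol{y})$, $\boldsymbol{x},\boldsymbol{y}\in\mathbb{R}^d$, be a covariance kernel and let $\mathcal{L}$ be a spatial (possibly fractional-order) differential operator on functions on $\mathbb{R}^d$. Suppose the following three conditions are satisfied. (1) $\mathcal{L}$ is a Fourier multiplier operator: $\mathcal{F}\{\mathcal{L}f\}(\boldsymbol{\xi})=m(\boldsymbol{\xi})\cdot\mathcal{F}\{f\}(\boldsymbol{\xi})$ for some function $m$ (the multiplier). (2) The covariance kernel $k$ is stationary: $k(\boldsymbol{x},\boldsymbol{y})=K(\boldsymbol{x}-\boldsymbol{y})$. (3) The (forward) Fourier transform $\hat K(\boldsymbol{\xi})=\mathcal{F}\{K\}(\boldsymbol{\xi})$ of the stationary covariance kernel $K$ is known analytically. Then the derivatives $\mathcal{L}_{\boldsymbol{x}}k$, $\mathcal{L}_{\boldsymbol{y}}k=\left[\mathcal{L}_{\boldsymbol{x}}k\right]^T$, and $\mathcal{L}_{\boldsymbol{y}}\mathcal{L}_{\boldsymbol{x}}k$ of the covariance kernel can be computed by the $d$-dimensional integrals $$\mathcal{L}_{\boldsymbol{x}}k=\frac{1}{\sqrt{2\pi}}\int_{\mathbb{R}^d}e^{i\langle \boldsymbol{x}-\boldsymbol{y},\boldsymbol{\xi}\rangle}\,m(\boldsymbol{\xi})\,\hat K(\boldsymbol{\xi})\,d\boldsymbol{\xi},$$ $$\mathcal{L}_{\boldsymbol{y}}\mathcal{L}_{\boldsymbol{x}}k=\frac{1}{\sqrt{2\pi}}\int_{\mathbb{R}^d}e^{i\langle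 \boldsymbol{x}-\boldsymbol{y},\boldsymbol{\xi}\rangle}\,m(\boldsymbol{\xi})\,m(-\boldsymbol{\xi})\,\hat K(\boldsymbol{\xi})\,d\boldsymbol{\xi}.$$
   Context: A covariance kernel is a symmetric, positive semidefinite function of two points of $\mathbb{R}^d$. The Fourier transform convention is $$\mathcal{F}f=\frac{1}{(2\pi)^{d/2}}\int_{\mathbb{R}^d}e^{-i\boldsymbol{\xi}\cdot\boldsymbol{x}}f(\boldsymbol{x})\,d\boldsymbol{x},\qquad \mathcal{F}^{-1}\hat f=\frac{1}{(2\pi)^{d/2}}\int_{\mathbb{R}^d}e^{i\boldsymbol{\xi}\cdot\boldsymbol{x}}\hat f(\boldsymbol{\xi})\,d\boldsymbol{\xi}.$$ For a function $F(\boldsymbol{x},\boldsymbol{y})$ of two variables, $\mathcal{L}_{\boldsymbol{x}}F$ (respectively $\mathcal{L}_{\boldsymbol{y}}F$) denotes the result of applying $\mathcal{L}$ to $F$ in the variable $\boldsymbol{x}$ (respectively $\boldsymbol{y}$) with the other variable fixed; $\mathcal{L}_{\boldsymbol{y}}\mathcal{L}_{\boldsymbol{x}}k$ means $\mathcal{L}_{\boldsymbol{y}}[\mathcal{L}_{\boldsymbol{x}}k]$. The transpose is defined by $F^T(\boldsymbol{x},\boldsymbol{y})=F(\boldsymbol{y},\boldsymbol{x})$. The bracket $\langle\cdot,\cdot\rangle$ is the Euclidean inner product on $\mathbb{R}^d$. An example of an operator satisfying (1) is the fractional Laplacian $(-\Delta)^{\alpha/2}$, with $m(\boldsymbol{\xi})=|\boldsymbol{\xi}|^\alpha$;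 examples of kernels satisfying (2) and (3) are the squared-exponential and Matérn kernels.
   Formalization: The prefactor 1/sqrt(2π), wrong for d≥2 under the stated convention, is replaced by (2π)^(-d/2); the kernel K, the functions L acts on and their images are taken integrable, the derivatives exist and are continuous, and the integrands on the right are integrable. *)

theory Defs
  imports "HOL-Analysis.Analysis"
begin

definition covariance_kernel :: "(real ^ 'd \<Rightarrow> real ^ 'd \<Rightarrow> real) \<Rightarrow> bool" where
  "covariance_kernel k \<longleftrightarrow>
     (\<forall>x y. k x y = k y x) \<and>
     (\<forall>X c. finite X \<longrightarrow> 0 \<le> (\<Sum>x\<in>X. \<Sum>y\<in>X. c x * c y * k x y))"

(* Unitary convention. Meaningful only for integrable f: the Bochner integral is 0 otherwise. *)
definition fourier :: "(real ^ 'd \<Rightarrow> complex) \<Rightarrow> real ^ 'd \<Rightarrow> complex" where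
  "fourier f \<xi> =
     complex_of_real (1 / (2 * pi) powr (real CARD('d) / 2)) *
     (\<integral>x. exp (- \<i> * complex_of_real (\<xi> \<bullet> x)) * f x \<partial>lborel)"

(* D is the domain of the operator L; the values of L outside D are irrelevant.  Both f and L f
   are required to be integrable so that the two Fourier transforms are defined by the integral. *)
definition fourier_multiplier_on ::
  "(real ^ 'd \<Rightarrow> complex) set \<Rightarrow> ((real ^ 'd \<Rightarrow> complex) \<Rightarrow> real ^ 'd \<Rightarrow> complex) \<Rightarrow>
   (real ^ 'd \<Rightarrow> complex) \<Rightarrow> bool" where
  "fourier_multiplier_on D L m \<longleftrightarrow>
     (\<forall>f\<in>D. integrable lborel f \<and> integrable lborel (L f) \<and>
            (\<forall>\<xi>. fourier (L f) \<xi> = m \<xi> * fourier f \<xi>))"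

definition apply_x :: "(('a \<Rightarrow> 'b) \<Rightarrow> 'a \<Rightarrow> 'b) \<Rightarrow> ('a \<Rightarrow> 'a \<Rightarrow> 'b) \<Rightarrow> 'a \<Rightarrow> 'a \<Rightarrow> 'b" where
  "apply_x L F x y = L (\<lambda>x'. F x' y) x"

definition apply_y :: "(('a \<Rightarrow> 'b) \<Rightarrow> 'a \<Rightarrow> 'b) \<Rightarrow> ('a \<Rightarrow> 'a \<Rightarrow> 'b) \<Rightarrow> 'a \<Rightarrow> 'a \<Rightarrow> 'b" where
  "apply_y L F x y = L (\<lambda>y'. F x y') y"

definition transpose_fun :: "('a \<Rightarrow> 'a \<Rightarrow> 'b) \<Rightarrow> 'a \<Rightarrow> 'a \<Rightarrow> 'b" where
  "transpose_fun F x y = F y x"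

(* Kernels are real-valued, but operators with complex multipliers act on complex functions. *)
definition cplx_kernel :: "('a \<Rightarrow> 'a \<Rightarrow> real) \<Rightarrow> 'a \<Rightarrow> 'a \<Rightarrow> complex" where
  "cplx_kernel k x y = complex_of_real (k x y)"

end

(*
  The section k(., y) is K translated by y, so its Fourier transform is exp(-i<xi,y>) Khat(xi), and
  applying L multiplies it by m(xi).  The first formula is then Fourier inversion for the continuous
  integrable function L_x k(., y).  As a function of y, L_x k(x, .) is G(x - y) with G = L K; the
  reflection turns the transform m Khat of G into exp(-i<xi,x>) m(-xi) Khat(-xi), L contributes the
  factor m(xi), and inversion followed by the substitution xi -> -xi gives the second formula.

  Fourier inversion itself is obtained by damping the inversion integral with a Gaussian of width s:
  by Fubini and the self-duality of the Gaussian the damped integral is a convolution of f with an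
  approximate identity, and both sides converge as s tends to infinity.
*)
theory Submission
  imports Defs "HOL-Probability.Characteristic_Functions" "HOL-Real_Asymp.Real_Asymp"
begin

section \<open>Affine substitutions and coordinate products in Lebesgue integrals\<close>

text \<open>Lebesgue measure is its own image under the map x -> t + c x, reweighted by the constant
  density |c|^DIM, so integrability transfers through the density and the image measure.\<close>

lemma lborel_integrable_affine:
  fixes f :: "'a::euclidean_space \<Rightarrow> 'b::{banach, second_countable_topology}"
  assumes f: "integrable lborel f" and c: "c \<noteq> 0"
  shows "integrable lborel (\<lambda>x. f (t + c *\<^sub>R x))"
proof -
  have [measurable]: "f \<in> borel_measurable borel"
    using borel_measurable_integrable[OF f] by simp
  have "integrable (density (distr lborel borel (\<lambda>x. t + c *\<^sub>R x)) (\<lambda>_. ennreal (\<bar>c\<bar> ^ DIM('a)))) f"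
    using f by (subst lborel_affine[OF c, of t, symmetric])
  then have "integrable lborel (\<lambda>x. (\<bar>c\<bar> ^ DIM('a)) *\<^sub>R f (t + c *\<^sub>R x))"
    by (simp add: integrable_density integrable_distr_eq)
  from integrable_scaleR_right[OF this, of "1 / \<bar>c\<bar> ^ DIM('a)"] show ?thesis
    using c by simp
qed

lemma lborel_integral_affine:
  fixes f :: "'a::euclidean_space \<Rightarrow> 'b::{banach, second_countable_topology}"
  assumes f[measurable]: "f \<in> borel_measurable borel" and c: "c \<noteq> 0"
  shows "(\<integral>x. f x \<partial>lborel) = \<bar>c\<bar> ^ DIM('a) *\<^sub>R (\<integral>x. f (t + c *\<^sub>R x) \<partial>lborel)"
proof -
  have "(\<integral>x. f x \<partial>lborel) =
      (\<integral>x. f x \<partial>density (distr lborel borel (\<lambda>x. t + c *\<^sub>R x)) (\<lambda>_. ennreal (\<bar>c\<bar> ^ DIM('a))))"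
    by (subst lborel_affine[OF c, of t, symmetric]) simp
  also have "\<dots> = \<bar>c\<bar> ^ DIM('a) *\<^sub>R (\<integral>x. f (t + c *\<^sub>R x) \<partial>lborel)"
    by (simp add: integral_density integral_distr)
  finally show ?thesis .
qed

text \<open>Lebesgue measure is the image of the product of one-dimensional Lebesgue measures over
  \<open>Basis\<close>, so Fubini for finite products applies. This reduces the Gaussian integral to
  dimension one.\<close>

lemma lborel_has_bochner_integral_prod:
  fixes f :: "'a::euclidean_space \<Rightarrow> real \<Rightarrow> complex"
  assumes f: "\<And>b. b \<in> Basis \<Longrightarrow> has_bochner_integral lborel (f b) (I b)"
  shows "has_bochner_integral lborel (\<lambda>x. \<Prod>b\<in>Basis. f b (x \<bullet> b)) (\<Prod>b\<in>Basis. I b)"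
proof -
  interpret product_sigma_finite "\<lambda>_::'a. lborel :: real measure" ..
  have int: "integrable lborel (f b)" and I: "integral\<^sup>L lborel (f b) = I b" if "b \<in> Basis" for b
    using f[OF that] by (simp_all add: has_bochner_integral_iff)
  have f_meas: "f b \<in> borel_measurable borel" if "b \<in> Basis" for b
    using int[OF that] by (auto dest: borel_measurable_integrable)
  have comp: "(\<Prod>b\<in>Basis. f b ((\<Sum>j\<in>Basis. x j *\<^sub>R j) \<bullet> b)) = (\<Prod>b\<in>Basis. f b (x b))" for x
    by (intro prod.cong refl) simp
  have meas: "(\<lambda>x::'a. \<Prod>b\<in>Basis. f b (x \<bullet> b)) \<in> borel_measurable borel"
    by (intro borel_measurable_prod measurable_compose[OF _ f_meas]) auto
  have "integrable (\<Pi>\<^sub>M b\<in>(Basis::'a set). lborel) (\<lambda>x. \<Prod>b\<in>Basis. f b (x b))"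
    by (intro product_integrable_prod int finite_Basis)
  moreover have "(\<integral>x. (\<Prod>b\<in>Basis. f b (x b)) \<partial>(\<Pi>\<^sub>M b\<in>(Basis::'a set). lborel)) = (\<Prod>b\<in>Basis. I b)"
    by (subst product_integral_prod) (auto intro: int I prod.cong)
  ultimately show ?thesis
    using meas by (subst lborel_eq) (simp add: has_bochner_integral_iff integrable_distr_eq integral_distr comp)
qed

section \<open>The Fourier transform of the Gaussian\<close>

text \<open>Up to the factor sqrt(2 pi) this integral is the characteristic function of the standard
  normal distribution.\<close>

lemma gaussian_fourier_real:
  fixes w :: real
  shows "has_bochner_integral lborel
    (\<lambda>\<xi>. exp (\<i> * complex_of_real (\<xi> * w)) * complex_of_real (exp (- \<xi>\<^sup>2 / 2)))
    (complex_of_real (sqrt (2 * pi) * exp (- w\<^sup>2 / 2)))"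
proof -
  let ?h = "\<lambda>\<xi>. exp (\<i> * complex_of_real (\<xi> * w)) * complex_of_real (exp (- \<xi>\<^sup>2 / 2))"
  have h: "std_normal_density \<xi> *\<^sub>R exp (\<i> * complex_of_real (w * \<xi>)) = (1 / sqrt (2 * pi)) *\<^sub>R ?h \<xi>" for \<xi>
    by (simp add: std_normal_density_def scaleR_conv_of_real mult_ac)
  have int: "integrable lborel (\<lambda>\<xi>. std_normal_density \<xi> *\<^sub>R exp (\<i> * complex_of_real (w * \<xi>)))"
    by (rule Bochner_Integration.integrable_bound[of _ std_normal_density])
       (auto simp: norm_mult)
  have "(CLINT \<xi>|lborel. std_normal_density \<xi> *\<^sub>R exp (\<i> * complex_of_real (w * \<xi>))) = char std_normal_distribution w"
    by (simp add: char_def integral_density)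
  then have "has_bochner_integral lborel (\<lambda>\<xi>. (1 / sqrt (2 * pi)) *\<^sub>R ?h \<xi>) (complex_of_real (exp (- w\<^sup>2 / 2)))"
    using int unfolding h by (simp add: has_bochner_integral_iff char_std_normal_distribution)
  from has_bochner_integral_scaleR_right[OF this, of "sqrt (2 * pi)"] show ?thesis
    by (simp add: scaleR_conv_of_real)
qed

text \<open>Both the phase and the Gaussian factor over the coordinates, so the integral is a
  product of one-dimensional ones.\<close>

lemma gaussian_fourier:
  fixes w :: "'a::euclidean_space"
  shows "has_bochner_integral lborel
    (\<lambda>\<xi>. exp (\<i> * complex_of_real (\<xi> \<bullet> w)) * complex_of_real (exp (- (norm \<xi>)\<^sup>2 / 2)))
    (complex_of_real ((2 * pi) powr (real DIM('a) / 2) * exp (- (norm w)\<^sup>2 / 2)))"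
proof -
  have norm_sum: "(norm x)\<^sup>2 = (\<Sum>b\<in>Basis. (x \<bullet> b)\<^sup>2)" for x :: 'a
    by (simp add: norm_eq_sqrt_inner euclidean_inner[of x x] power2_eq_square sum_nonneg)
  have exp_prod: "(\<Prod>b\<in>Basis. exp (- (x \<bullet> b)\<^sup>2 / 2)) = exp (- (norm x)\<^sup>2 / 2)" for x :: 'a
    by (simp add: norm_sum exp_sum[symmetric] sum_negf sum_divide_distrib)
  have iexp_prod: "(\<Prod>b\<in>Basis. exp (\<i> * complex_of_real ((x \<bullet> b) * (w \<bullet> b)))) = exp (\<i> * complex_of_real (x \<bullet> w))"
    for x :: 'a
    by (simp add: exp_sum[symmetric] euclidean_inner[of x w] sum_distrib_left)
  have const: "sqrt (2 * pi) ^ DIM('a) = (2 * pi) powr (real DIM('a) / 2)"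
    by (simp add: powr_half_sqrt[symmetric] powr_realpow[symmetric] powr_powr)
  have "has_bochner_integral lborel
      (\<lambda>x. \<Prod>b\<in>Basis. exp (\<i> * complex_of_real ((x \<bullet> b) * (w \<bullet> b))) * complex_of_real (exp (- (x \<bullet> b)\<^sup>2 / 2)))
      (\<Prod>b\<in>Basis. complex_of_real (sqrt (2 * pi) * exp (- (w \<bullet> b)\<^sup>2 / 2)))"
    by (intro lborel_has_bochner_integral_prod gaussian_fourier_real)
  then show ?thesis
    by (simp only: prod.distrib of_real_prod[symmetric] exp_prod iexp_prod prod_constant const)
qed

text \<open>Rescaling the frequency by 1 / s exchanges widths: a Gaussian of width s becomes one of
  width 1 / s and height proportional to s^DIM, which is the approximate identity used for
  inversion.\<close>

lemma gaussian_fourier_scaled: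
  fixes w :: "'a::euclidean_space"
  assumes s: "0 < s"
  shows "has_bochner_integral lborel
    (\<lambda>\<xi>. exp (\<i> * complex_of_real (\<xi> \<bullet> w)) * complex_of_real (exp (- (norm \<xi> / s)\<^sup>2 / 2)))
    (complex_of_real ((2 * pi) powr (real DIM('a) / 2) * (s ^ DIM('a) * exp (- (s * norm w)\<^sup>2 / 2))))"
proof -
  let ?g = "\<lambda>\<xi>::'a. exp (\<i> * complex_of_real (\<xi> \<bullet> (s *\<^sub>R w))) * complex_of_real (exp (- (norm \<xi>)\<^sup>2 / 2))"
  have g: "?g (0 + (1 / s) *\<^sub>R \<xi>) = exp (\<i> * complex_of_real (\<xi> \<bullet> w)) * complex_of_real (exp (- (norm \<xi> / s)\<^sup>2 / 2))" for \<xi>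
    using s by simp
  have hb: "has_bochner_integral lborel ?g
      (complex_of_real ((2 * pi) powr (real DIM('a) / 2) * exp (- (norm (s *\<^sub>R w))\<^sup>2 / 2)))"
    by (rule gaussian_fourier)
  have int: "integrable lborel (\<lambda>\<xi>. ?g (0 + (1 / s) *\<^sub>R \<xi>))"
    using hb s by (intro lborel_integrable_affine) (auto simp: has_bochner_integral_iff)
  have "integral\<^sup>L lborel ?g = \<bar>1 / s\<bar> ^ DIM('a) *\<^sub>R (\<integral>\<xi>. ?g (0 + (1 / s) *\<^sub>R \<xi>) \<partial>lborel)"
    using s by (intro lborel_integral_affine) auto
  then have "(\<integral>\<xi>. ?g (0 + (1 / s) *\<^sub>R \<xi>) \<partial>lborel) = s ^ DIM('a) *\<^sub>R integral\<^sup>L lborel ?g"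
    using s by (simp add: power_one_over)
  also have "\<dots> = complex_of_real ((2 * pi) powr (real DIM('a) / 2) * (s ^ DIM('a) * exp (- (s * norm w)\<^sup>2 / 2)))"
    using has_bochner_integral_integral_eq[OF hb] s by (simp add: scaleR_conv_of_real mult_ac)
  finally show ?thesis
    using int unfolding g by (simp add: has_bochner_integral_iff)
qed

lemma integrable_gaussian:
  "integrable lborel (\<lambda>x::'a::euclidean_space. complex_of_real (exp (- (norm x)\<^sup>2 / 2)))"
  and integral_gaussian:
  "(\<integral>x. complex_of_real (exp (- (norm (x::'a::euclidean_space))\<^sup>2 / 2)) \<partial>lborel) = complex_of_real ((2 * pi) powr (real DIM('a) / 2))"
  using gaussian_fourier[of "0::'a"] by (simp_all add: has_bochner_integral_iff)

section \<open>Fourier inversion by Gaussian damping\<close>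

text \<open>The Gaussian factor makes the double integral absolutely convergent, so the order of
  integration can be exchanged; the integral over the frequency is then the transform of a Gaussian
  at x - y.\<close>

lemma damped_fourier_inversion:
  fixes f :: "'a::euclidean_space \<Rightarrow> complex"
  assumes f: "integrable lborel f" and s: "0 < s"
  shows "(\<integral>\<xi>. exp (\<i> * complex_of_real (\<xi> \<bullet> x)) * (\<integral>y. exp (- \<i> * complex_of_real (\<xi> \<bullet> y)) * f y \<partial>lborel)
        * complex_of_real (exp (- (norm \<xi> / s)\<^sup>2 / 2)) \<partial>lborel)
    = complex_of_real ((2 * pi) powr (real DIM('a) / 2)) *
      (\<integral>y. complex_of_real (s ^ DIM('a) * exp (- (s * norm (x - y))\<^sup>2 / 2)) * f y \<partial>lborel)"
proof -
  let ?g = "\<lambda>\<xi>::'a. complex_of_real (exp (- (norm \<xi> / s)\<^sup>2 / 2))"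
  \<comment> \<open>The phases of the transform and of its inversion are merged into a single phase
    at x - y.\<close>
  let ?F = "\<lambda>y \<xi>. exp (\<i> * complex_of_real (\<xi> \<bullet> (x - y))) * ?g \<xi> * f y"
  have [measurable]: "f \<in> borel_measurable borel"
    using borel_measurable_integrable[OF f] by simp
  have gauss: "integrable lborel (\<lambda>\<xi>. exp (\<i> * complex_of_real (\<xi> \<bullet> w)) * ?g \<xi>)"
    "(\<integral>\<xi>. exp (\<i> * complex_of_real (\<xi> \<bullet> w)) * ?g \<xi> \<partial>lborel) =
      complex_of_real ((2 * pi) powr (real DIM('a) / 2) * (s ^ DIM('a) * exp (- (s * norm w)\<^sup>2 / 2)))" for w
    using gaussian_fourier_scaled[OF s, of w] by (simp_all add: has_bochner_integral_iff)
  have "integrable (lborel \<Otimes>\<^sub>M lborel) (case_prod ?F)"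
  proof (rule lborel_pair.Fubini_integrable)
    show "case_prod ?F \<in> borel_measurable (lborel \<Otimes>\<^sub>M lborel)"
      by measurable
    \<comment> \<open>The phase has modulus one, so what remains is |f y| times a constant
      independent of y.\<close>
    have "(\<integral>\<xi>. norm (case_prod ?F (y, \<xi>)) \<partial>lborel) = norm (f y) * (\<integral>\<xi>. norm (?g \<xi>) \<partial>lborel)" for y
      by (simp add: norm_mult mult.commute)
    then show "integrable lborel (\<lambda>y. \<integral>\<xi>. norm (case_prod ?F (y, \<xi>)) \<partial>lborel)"
      using f by simp
    show "AE y in lborel. integrable lborel (\<lambda>\<xi>. case_prod ?F (y, \<xi>))"
      using gauss(1) by simp
  qed
  then have "(\<integral>\<xi>. (\<integral>y. ?F y \<xi> \<partial>lborel) \<partial>lborel) = (\<integral>y. (\<integral>\<xi>. ?F y \<xi> \<partial>lborel) \<partial>lborel)"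
    by (rule lborel_pair.Fubini_integral)
  moreover have "(\<integral>y. ?F y \<xi> \<partial>lborel) =
      exp (\<i> * complex_of_real (\<xi> \<bullet> x)) * (\<integral>y. exp (- \<i> * complex_of_real (\<xi> \<bullet> y)) * f y \<partial>lborel) * ?g \<xi>" for \<xi>
  proof -
    have F_eq: "?F y \<xi> = (exp (\<i> * complex_of_real (\<xi> \<bullet> x)) * ?g \<xi>) * (exp (- \<i> * complex_of_real (\<xi> \<bullet> y)) * f y)" for y
      by (simp add: exp_add[symmetric] algebra_simps)
    show ?thesis
      unfolding F_eq integral_mult_right_zero by (simp only: mult_ac)
  qed
  moreover have "(\<integral>\<xi>. ?F y \<xi> \<partial>lborel) = complex_of_real ((2 * pi) powr (real DIM('a) / 2)) *
      (complex_of_real (s ^ DIM('a) * exp (- (s * norm (x - y))\<^sup>2 / 2)) * f y)" for y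
    using gauss(2)[of "x - y"] by simp
  ultimately show ?thesis
    by (simp only: integral_mult_right_zero)
qed

text \<open>The kernels all have mass (2 pi)^(DIM/2) and concentrate at \<open>x\<close>; continuity
  of \<open>f\<close> gives the limit at every point. The scale \<open>Suc n\<close> is positive
  already for n = 0.\<close>

lemma gaussian_approximate_identity:
  fixes f :: "'a::euclidean_space \<Rightarrow> complex"
  assumes f: "integrable lborel f" and cont: "continuous_on UNIV f"
  shows "(\<lambda>n. \<integral>y. complex_of_real (real (Suc n) ^ DIM('a) * exp (- (real (Suc n) * norm (x - y))\<^sup>2 / 2)) * f y \<partial>lborel)
    \<longlonglongrightarrow> complex_of_real ((2 * pi) powr (real DIM('a) / 2)) * f x"
proof -
  \<comment> \<open>\<open>f\<close> need not be bounded, so dominated convergence applies only to its part near \<open>x\<close>; away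
    from \<open>x\<close> the kernel tends to 0 uniformly and \<open>f\<close> is integrable.\<close>
  define near where "near y = (if dist x y \<le> 1 then f y else 0)" for y
  define far where "far y = (if dist x y \<le> 1 then 0 else f y)" for y
  define k where "k n y = complex_of_real (real (Suc n) ^ DIM('a) * exp (- (real (Suc n) * norm (x - y))\<^sup>2 / 2))"
    for n y
  have [measurable]: "f \<in> borel_measurable borel"
    using borel_measurable_integrable[OF f] by simp
  have [measurable]: "near \<in> borel_measurable borel"
    unfolding near_def[abs_def] by measurable
  have [measurable]: "far \<in> borel_measurable borel"
    unfolding far_def[abs_def] by measurable
  have [measurable]: "k n \<in> borel_measurable borel" for n
    unfolding k_def[abs_def] by measurable
  have int: "integrable lborel near" "integrable lborel far"
    by (rule Bochner_Integration.integrable_bound[OF f]; simp add: near_def far_def)+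
  have k_le: "norm (k n y) \<le> real (Suc n) ^ DIM('a)" for n y
    by (simp add: k_def norm_mult norm_power mult_le_cancel_left1 del: of_nat_Suc)
  have int_k: "integrable lborel (\<lambda>y. k n y * h y)" if h: "integrable lborel h" for n and h :: "'a \<Rightarrow> complex"
  proof (rule Bochner_Integration.integrable_bound)
    show "integrable lborel (\<lambda>y. real (Suc n) ^ DIM('a) * norm (h y))"
      using h by simp
    show "(\<lambda>y. k n y * h y) \<in> borel_measurable lborel"
      using borel_measurable_integrable[OF h] by simp
    show "AE y in lborel. norm (k n y * h y) \<le> norm (real (Suc n) ^ DIM('a) * norm (h y))"
      using k_le[of n] by (auto simp: norm_mult intro!: mult_right_mono simp del: of_nat_Suc)
  qed
  have split: "(\<integral>y. k n y * f y \<partial>lborel) = (\<integral>y. k n y * near y \<partial>lborel) + (\<integral>y. k n y * far y \<partial>lborel)" for n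
  proof -
    have "(\<integral>y. k n y * f y \<partial>lborel) = (\<integral>y. k n y * near y + k n y * far y \<partial>lborel)"
      by (intro Bochner_Integration.integral_cong) (auto simp: near_def far_def)
    also have "\<dots> = (\<integral>y. k n y * near y \<partial>lborel) + (\<integral>y. k n y * far y \<partial>lborel)"
      by (intro Bochner_Integration.integral_add int_k int)
    finally show ?thesis .
  qed
  have "(\<lambda>n. \<integral>y. k n y * far y \<partial>lborel) \<longlonglongrightarrow> 0"
  proof (rule Lim_null_comparison)
    \<comment> \<open>The value of the kernel at distance 1 from \<open>x\<close>, hence an upper
      bound at all larger distances; its Gaussian decay in n beats the power of n.\<close>
    let ?b = "\<lambda>n. real (Suc n) ^ DIM('a) * exp (- (real (Suc n))\<^sup>2 / 2)"
    have "norm (\<integral>y. k n y * far y \<partial>lborel) \<le> ?b n * (\<integral>y. norm (far y) \<partial>lborel)" for n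
    proof -
      have "norm (k n y * far y) \<le> ?b n * norm (far y)" for y
      proof (cases "dist x y \<le> 1")
        case False
        then have "1 \<le> norm (x - y)"
          by (simp add: dist_norm)
        then have "real (Suc n) \<le> real (Suc n) * norm (x - y)"
          by (simp add: mult_le_cancel_left1 del: of_nat_Suc)
        then have "norm (k n y) \<le> ?b n"
          by (simp add: k_def norm_mult norm_power power_mono del: of_nat_Suc)
        then show ?thesis
          by (simp only: norm_mult mult_right_mono norm_ge_zero)
      qed (simp add: far_def)
      then have "(\<integral>y. norm (k n y * far y) \<partial>lborel) \<le> (\<integral>y. ?b n * norm (far y) \<partial>lborel)"
        using int by (intro integral_mono) (auto intro!: integrable_norm int_k simp del: of_nat_Suc)
      then show ?thesis
        using integral_norm_bound[of lborel "\<lambda>y. k n y * far y"]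
        by (simp only: integral_mult_right_zero order_trans)
    qed
    then show "\<forall>\<^sub>F n in sequentially. norm (\<integral>y. k n y * far y \<partial>lborel) \<le> ?b n * (\<integral>y. norm (far y) \<partial>lborel)"
      by simp
    have "?b \<longlonglongrightarrow> 0"
      by real_asymp
    then show "(\<lambda>n. ?b n * (\<integral>y. norm (far y) \<partial>lborel)) \<longlonglongrightarrow> 0"
      by (rule tendsto_mult_left_zero)
  qed
  moreover have "(\<lambda>n. \<integral>y. k n y * near y \<partial>lborel) \<longlonglongrightarrow> complex_of_real ((2 * pi) powr (real DIM('a) / 2)) * f x"
  proof -
    let ?g = "\<lambda>z::'a. complex_of_real (exp (- (norm z)\<^sup>2 / 2))"
    let ?p = "\<lambda>n z. x + (1 / real (Suc n)) *\<^sub>R z"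
    \<comment> \<open>The substitution y = x + z / (n + 1) turns the kernel into a fixed Gaussian:
      the Jacobian cancels the power of n + 1, and n survives only in the argument of
      \<open>near\<close>.\<close>
    have subst: "(\<integral>y. k n y * near y \<partial>lborel) = (\<integral>z. ?g z * near (?p n z) \<partial>lborel)" for n
    proof -
      have "(\<integral>y. k n y * near y \<partial>lborel) =
          \<bar>1 / real (Suc n)\<bar> ^ DIM('a) *\<^sub>R (\<integral>z. k n (?p n z) * near (?p n z) \<partial>lborel)"
        by (rule lborel_integral_affine) (auto simp del: of_nat_Suc)
      also have "\<dots> = (\<integral>z. \<bar>1 / real (Suc n)\<bar> ^ DIM('a) *\<^sub>R (k n (?p n z) * near (?p n z)) \<partial>lborel)"
        by simp
      also have "\<dots> = (\<integral>z. ?g z * near (?p n z) \<partial>lborel)"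
        by (intro Bochner_Integration.integral_cong refl)
           (simp add: k_def scaleR_conv_of_real power_one_over del: of_nat_Suc)
      finally show ?thesis .
    qed
    \<comment> \<open>The closed unit ball around \<open>x\<close> is compact, so the continuous
      \<open>f\<close> is bounded on it; this bound times the Gaussian is the dominating
      function.\<close>
    obtain B where B: "norm (f y) \<le> B" if "dist x y \<le> 1" for y
      using compact_imp_bounded[OF compact_continuous_image[OF continuous_on_subset[OF cont] compact_cball]]
      unfolding bounded_iff by (metis UNIV_I image_eqI mem_cball subsetI)
    \<comment> \<open>This covers the points outside the ball, where \<open>near\<close> is
      0.\<close>
    have "0 \<le> B"
      using order_trans[OF norm_ge_zero B[of x]] by simp
    then have near_le: "norm (near y) \<le> B" for y
      using B by (simp add: near_def)
    have "(\<lambda>n. \<integral>z. ?g z * near (?p n z) \<partial>lborel) \<longlonglongrightarrow> (\<integral>z. ?g z * f x \<partial>lborel)"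
    proof (rule integral_dominated_convergence)
      show "integrable lborel (\<lambda>z. norm (?g z) * B)"
        by (intro integrable_mult_left integrable_norm integrable_gaussian)
      show "AE z in lborel. norm (?g z * near (?p n z)) \<le> norm (?g z) * B" for n
        using near_le by (auto simp: norm_mult intro!: mult_left_mono)
      \<comment> \<open>The points x + z / (n + 1) eventually lie in the ball, where
        \<open>near\<close> agrees with \<open>f\<close>, so a jump of \<open>near\<close> at the
        boundary sphere does no harm.\<close>
      have "(\<lambda>n. near (?p n z)) \<longlonglongrightarrow> f x" for z
      proof -
        have p: "(\<lambda>n. ?p n z) \<longlonglongrightarrow> x"
          using tendsto_add[OF tendsto_const tendsto_scaleR[OF LIMSEQ_inverse_real_of_nat tendsto_const], of x z]
          by (simp add: inverse_eq_divide del: of_nat_Suc)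
        then have "\<forall>\<^sub>F n in sequentially. dist x (?p n z) \<le> 1"
          using tendstoD[OF p, of 1] by (auto elim!: eventually_mono simp: dist_commute)
        then have "\<forall>\<^sub>F n in sequentially. f (?p n z) = near (?p n z)"
          by (auto elim!: eventually_mono simp: near_def)
        moreover have "(\<lambda>n. f (?p n z)) \<longlonglongrightarrow> f x"
          using cont p by (auto intro: isCont_tendsto_compose simp: continuous_on_eq_continuous_at)
        ultimately show ?thesis
          by (rule Lim_transform_eventually[rotated])
      qed
      then show "AE z in lborel. (\<lambda>n. ?g z * near (?p n z)) \<longlonglongrightarrow> ?g z * f x"
        by (auto intro!: tendsto_mult)
    qed measurable
    then show ?thesis
      by (simp only: subst integral_mult_left_zero integral_gaussian)
  qed
  ultimately have "(\<lambda>n. \<integral>y. k n y * f y \<partial>lborel) \<longlonglongrightarrow> complex_of_real ((2 * pi) powr (real DIM('a) / 2)) * f x + 0"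
    unfolding split by (intro tendsto_add)
  then show ?thesis
    by (simp only: k_def add_0_right)
qed

text \<open>The damped integrals have two limits, which must agree: the undamped integral by
  dominated convergence, and a multiple of f x by the approximate identity. One factor (2
  pi)^(DIM/2) comes from the transform of the Gaussian, the other from the mass of the
  kernel.\<close>

lemma fourier_inversion_euclidean:
  fixes f :: "'a::euclidean_space \<Rightarrow> complex"
  defines "F \<equiv> \<lambda>\<xi>. \<integral>y. exp (- \<i> * complex_of_real (\<xi> \<bullet> y)) * f y \<partial>lborel"
  assumes f: "integrable lborel f" and cont: "continuous_on UNIV f" and F: "integrable lborel F"
  shows "(\<integral>\<xi>. exp (\<i> * complex_of_real (\<xi> \<bullet> x)) * F \<xi> \<partial>lborel)
    = complex_of_real ((2 * pi) powr real DIM('a)) * f x"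
proof (rule LIMSEQ_unique)
  let ?C = "complex_of_real ((2 * pi) powr (real DIM('a) / 2))"
  let ?I = "\<lambda>n. \<integral>\<xi>. exp (\<i> * complex_of_real (\<xi> \<bullet> x)) * F \<xi> * complex_of_real (exp (- (norm \<xi> / real (Suc n))\<^sup>2 / 2)) \<partial>lborel"
  have [measurable]: "F \<in> borel_measurable borel"
    using borel_measurable_integrable[OF F] by simp
  show "?I \<longlonglongrightarrow> (\<integral>\<xi>. exp (\<i> * complex_of_real (\<xi> \<bullet> x)) * F \<xi> \<partial>lborel)"
  proof (rule integral_dominated_convergence)
    show "integrable lborel (\<lambda>\<xi>. norm (F \<xi>))"
      using F by simp
    have "(\<lambda>n. exp (- (r / real (Suc n))\<^sup>2 / 2)) \<longlonglongrightarrow> exp (- 0\<^sup>2 / 2)" for r :: real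
      using tendsto_mult[OF tendsto_const LIMSEQ_inverse_real_of_nat, of r]
      by (intro tendsto_intros) (simp_all add: divide_inverse)
    from tendsto_of_real[OF this]
    have lim: "(\<lambda>n. complex_of_real (exp (- (r / real (Suc n))\<^sup>2 / 2))) \<longlonglongrightarrow> 1" for r
      by (simp del: of_nat_Suc)
    have "(\<lambda>n. exp (\<i> * complex_of_real (\<xi> \<bullet> x)) * F \<xi> * complex_of_real (exp (- (norm \<xi> / real (Suc n))\<^sup>2 / 2)))
        \<longlonglongrightarrow> exp (\<i> * complex_of_real (\<xi> \<bullet> x)) * F \<xi> * 1" for \<xi>
      by (intro tendsto_mult tendsto_const lim)
    then show "AE \<xi> in lborel. (\<lambda>n. exp (\<i> * complex_of_real (\<xi> \<bullet> x)) * F \<xi> * complex_of_real (exp (- (norm \<xi> / real (Suc n))\<^sup>2 / 2)))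
        \<longlonglongrightarrow> exp (\<i> * complex_of_real (\<xi> \<bullet> x)) * F \<xi>"
      by (intro AE_I2) (simp only: mult_1_right)
    show "AE \<xi> in lborel. norm (exp (\<i> * complex_of_real (\<xi> \<bullet> x)) * F \<xi> * complex_of_real (exp (- (norm \<xi> / real (Suc n))\<^sup>2 / 2)))
        \<le> norm (F \<xi>)" for n
      by (simp add: norm_mult mult_left_le del: of_nat_Suc)
  qed measurable
  have "?I n = ?C * (\<integral>y. complex_of_real (real (Suc n) ^ DIM('a) * exp (- (real (Suc n) * norm (x - y))\<^sup>2 / 2)) * f y \<partial>lborel)" for n
    unfolding F_def by (rule damped_fourier_inversion[OF f]) simp
  moreover have "?C * ?C = complex_of_real ((2 * pi) powr real DIM('a))"
    by (simp only: of_real_mult[symmetric] powr_add[symmetric] field_sum_of_halves)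
  ultimately show "?I \<longlonglongrightarrow> complex_of_real ((2 * pi) powr real DIM('a)) * f x"
    using tendsto_mult[OF tendsto_const gaussian_approximate_identity[OF f cont, of x], of ?C]
    by (simp only: mult.assoc[symmetric])
qed

text \<open>The unitary normalization of \<open>fourier\<close> absorbs one of the two factors (2
  pi)^(d/2) of the unnormalized inversion.\<close>

lemma fourier_inversion:
  fixes f :: "real ^ 'd \<Rightarrow> complex"
  assumes f: "integrable lborel f" and cont: "continuous_on UNIV f" and F: "integrable lborel (fourier f)"
  shows "f x = complex_of_real (1 / (2 * pi) powr (real CARD('d) / 2)) *
    (\<integral>\<xi>. exp (\<i> * complex_of_real (x \<bullet> \<xi>)) * fourier f \<xi> \<partial>lborel)"
proof -
  let ?C = "complex_of_real ((2 * pi) powr (real CARD('d) / 2))"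
  let ?F = "\<lambda>\<xi>. \<integral>y. exp (- \<i> * complex_of_real (\<xi> \<bullet> y)) * f y \<partial>lborel"
  have eq: "?F \<xi> = ?C * fourier f \<xi>" for \<xi>
    by (simp add: fourier_def)
  have "integrable lborel ?F"
    unfolding eq using F by simp
  from fourier_inversion_euclidean[OF f cont this, of x]
  have "?C * (\<integral>\<xi>. exp (\<i> * complex_of_real (x \<bullet> \<xi>)) * fourier f \<xi> \<partial>lborel) = complex_of_real ((2 * pi) powr real CARD('d)) * f x"
    unfolding eq by (simp only: mult.left_commute[of "exp _"] integral_mult_right_zero inner_commute[of x] DIM_cart DIM_real mult_1_right)
  also have "complex_of_real ((2 * pi) powr real CARD('d)) = ?C * ?C"
    by (simp only: of_real_mult[symmetric] powr_add[symmetric] field_sum_of_halves)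
  finally show ?thesis
    by (simp add: field_simps)
qed

section \<open>Fourier transforms of translates and reflections\<close>

text \<open>Here c is 1 or -1, so one statement serves both the translate K(x - y) in the first
  variable and the reflection y -> G(x - y) in the second.\<close>

lemma fourier_affine:
  fixes f :: "real ^ 'd \<Rightarrow> complex"
  assumes [measurable]: "f \<in> borel_measurable borel" and c: "\<bar>c\<bar> = 1"
  shows "fourier (\<lambda>x. f (a + c *\<^sub>R x)) \<xi> = exp (\<i> * complex_of_real (c * (\<xi> \<bullet> a))) * fourier f (c *\<^sub>R \<xi>)"
proof -
  have cc: "c * c = 1"
    using c by (auto simp: abs_if split: if_splits)
  have "c \<noteq> 0"
    using c by auto
  \<comment> \<open>The substitution u = a + c x, solved for x; since 1 / c = c it reads x = - c a +
    c u.\<close>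
  then have "(\<integral>x. exp (- \<i> * complex_of_real (\<xi> \<bullet> x)) * f (a + c *\<^sub>R x) \<partial>lborel) =
      (\<integral>u. exp (- \<i> * complex_of_real (\<xi> \<bullet> (- c *\<^sub>R a + c *\<^sub>R u))) * f (a + c *\<^sub>R (- c *\<^sub>R a + c *\<^sub>R u)) \<partial>lborel)"
    by (subst lborel_integral_affine[where c = c and t = "- c *\<^sub>R a"]) (simp_all add: c)
  also have "\<dots> = (\<integral>u. exp (\<i> * complex_of_real (c * (\<xi> \<bullet> a))) * (exp (- \<i> * complex_of_real (c *\<^sub>R \<xi> \<bullet> u)) * f u) \<partial>lborel)"
    by (simp add: cc algebra_simps exp_add[symmetric] flip: mult.assoc)
  finally show ?thesis
    by (simp add: fourier_def)
qed

section \<open>Integral formulas for the derivatives of a stationary kernel\<close>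

text \<open>The multiplier identity determines L f only up to null sets; the continuity hypotheses
  yield formulas at every point, and the integrability hypotheses make the inversion integrals
  converge absolutely. The unitary convention forces the factor (2 pi)^(-d/2), which equals 1 /
  sqrt(2 pi) exactly when d = 1. The regularity required for the second formula is a premise inside
  the conclusion, so it restricts that formula alone.\<close>

theorem theorem3p1:
  fixes k :: "real ^ 'd \<Rightarrow> real ^ 'd \<Rightarrow> real"
    and K :: "real ^ 'd \<Rightarrow> real"
    and Khat m :: "real ^ 'd \<Rightarrow> complex"
    and D :: "(real ^ 'd \<Rightarrow> complex) set"
    and L :: "(real ^ 'd \<Rightarrow> complex) \<Rightarrow> real ^ 'd \<Rightarrow> complex"
  assumes kernel: "covariance_kernel k"
    and multiplier: "fourier_multiplier_on D L m"
    and stationary: "\<And>x y. k x y = K (x - y)"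
    and K_integrable: "integrable lborel K"
    and Khat: "\<And>\<xi>. Khat \<xi> = fourier (\<lambda>x. complex_of_real (K x)) \<xi>"
    and dom_x: "\<And>y. (\<lambda>x. cplx_kernel k x y) \<in> D"
    and cont_x: "\<And>y. continuous_on UNIV (\<lambda>x. apply_x L (cplx_kernel k) x y)"
    and int_x: "integrable lborel (\<lambda>\<xi>. m \<xi> * Khat \<xi>)"
  shows
    "(\<forall>x y. apply_x L (cplx_kernel k) x y =
        complex_of_real (1 / (2 * pi) powr (real CARD('d) / 2)) *
        (\<integral>\<xi>. exp (\<i> * complex_of_real ((x - y) \<bullet> \<xi>)) * m \<xi> * Khat \<xi> \<partial>lborel)) \<and>
     apply_y L (cplx_kernel k) = transpose_fun (apply_x L (cplx_kernel k)) \<and>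
     ((\<forall>x. (\<lambda>y. apply_x L (cplx_kernel k) x y) \<in> D) \<and>
      (\<forall>x. continuous_on UNIV (\<lambda>y. apply_y L (apply_x L (cplx_kernel k)) x y)) \<and>
      integrable lborel (\<lambda>\<xi>. m \<xi> * m (- \<xi>) * Khat \<xi>) \<longrightarrow>
      (\<forall>x y. apply_y L (apply_x L (cplx_kernel k)) x y =
        complex_of_real (1 / (2 * pi) powr (real CARD('d) / 2)) *
        (\<integral>\<xi>. exp (\<i> * complex_of_real ((x - y) \<bullet> \<xi>)) * m \<xi> * m (- \<xi>) * Khat \<xi> \<partial>lborel)))"
proof -
  let ?c = "complex_of_real (1 / (2 * pi) powr (real CARD('d) / 2))"
  let ?K = "\<lambda>x. complex_of_real (K x)"
  \<comment> \<open>The section at y = 0 is K itself, so \<open>G\<close> is L applied to K.\<close>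
  define G where "G x = apply_x L (cplx_kernel k) x 0" for x
  have D: "integrable lborel f" "integrable lborel (L f)" "fourier (L f) \<xi> = m \<xi> * fourier f \<xi>"
    if "f \<in> D" for f \<xi>
    using multiplier that by (auto simp: fourier_multiplier_on_def)
  have cexp: "integrable lborel (\<lambda>\<xi>. exp (\<i> * complex_of_real (\<xi> \<bullet> a)) * h \<xi>)"
    if h: "integrable lborel h" for h :: "real ^ 'd \<Rightarrow> complex" and a
    using borel_measurable_integrable[OF h]
    by (intro Bochner_Integration.integrable_bound[OF h]) (auto simp: norm_mult)
  have [measurable]: "K \<in> borel_measurable borel"
    using borel_measurable_integrable[OF K_integrable] by simp
  have section_fourier: "fourier (\<lambda>x. cplx_kernel k x y) \<xi> = exp (\<i> * complex_of_real (\<xi> \<bullet> (- y))) * Khat \<xi>" for y \<xi>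
    using fourier_affine[of ?K 1 "- y" \<xi>] by (simp add: cplx_kernel_def stationary Khat)
  have Lx_fourier: "fourier (\<lambda>x. apply_x L (cplx_kernel k) x y) = (\<lambda>\<xi>. exp (\<i> * complex_of_real (\<xi> \<bullet> (- y))) * (m \<xi> * Khat \<xi>))"
    and Lx_int: "integrable lborel (\<lambda>x. apply_x L (cplx_kernel k) x y)" for y
    using D[OF dom_x[of y]] by (auto simp: apply_x_def section_fourier)
  have Lx: "apply_x L (cplx_kernel k) x y =
      ?c * (\<integral>\<xi>. exp (\<i> * complex_of_real ((x - y) \<bullet> \<xi>)) * m \<xi> * Khat \<xi> \<partial>lborel)" for x y
  proof -
    have "integrable lborel (fourier (\<lambda>x. apply_x L (cplx_kernel k) x y))"
      unfolding Lx_fourier by (intro cexp int_x)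
    from fourier_inversion[OF Lx_int cont_x this, of x] show ?thesis
      unfolding Lx_fourier
      by (simp add: inner_diff_left inner_commute[of y] exp_add[symmetric] algebra_simps flip: mult.assoc)
  qed
  \<comment> \<open>By symmetry of \<open>k\<close> the sections k(x, .) and k(., x) are the same
    function, so both sides apply \<open>L\<close> to the same argument.\<close>
  have sym: "apply_y L (cplx_kernel k) = transpose_fun (apply_x L (cplx_kernel k))"
    using kernel by (simp add: fun_eq_iff apply_y_def apply_x_def transpose_fun_def cplx_kernel_def covariance_kernel_def)
  have LyLx: "apply_y L (apply_x L (cplx_kernel k)) x y =
      ?c * (\<integral>\<xi>. exp (\<i> * complex_of_real ((x - y) \<bullet> \<xi>)) * m \<xi> * m (- \<xi>) * Khat \<xi> \<partial>lborel)"
    if dom_y: "(\<lambda>y. apply_x L (cplx_kernel k) x y) \<in> D"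
      and cont_y: "continuous_on UNIV (\<lambda>y. apply_y L (apply_x L (cplx_kernel k)) x y)"
      and int_xy: "integrable lborel (\<lambda>\<xi>. m \<xi> * m (- \<xi>) * Khat \<xi>)" for x y
  proof -
    \<comment> \<open>The factor m(xi) comes from the second application of \<open>L\<close>; m(-xi)
      Khat(-xi) is the transform of \<open>G\<close> reflected.\<close>
    let ?h = "\<lambda>\<xi>. m \<xi> * m (- \<xi>) * Khat (- \<xi>)"
    have [measurable]: "G \<in> borel_measurable borel"
      using borel_measurable_integrable[OF Lx_int[of 0]] by (simp add: G_def[abs_def])
    \<comment> \<open>That L_x k depends only on x - y is read off from the first formula;
      commutation of \<open>L\<close> with translations is a consequence here, not an
      assumption.\<close>
    have G: "apply_x L (cplx_kernel k) x y = G (x + (-1) *\<^sub>R y)" for y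
      by (simp add: G_def Lx)
    have G_fourier: "fourier G \<xi> = m \<xi> * Khat \<xi>" for \<xi>
      using Lx_fourier[of 0] by (simp add: G_def[abs_def])
    have "fourier (\<lambda>y. apply_x L (cplx_kernel k) x y) \<xi> = exp (\<i> * complex_of_real (\<xi> \<bullet> (- x))) * (m (- \<xi>) * Khat (- \<xi>))" for \<xi>
      unfolding G by (subst fourier_affine) (simp_all add: G_fourier)
    then have LyLx_fourier: "fourier (\<lambda>y. apply_y L (apply_x L (cplx_kernel k)) x y) = (\<lambda>\<xi>. exp (\<i> * complex_of_real (\<xi> \<bullet> (- x))) * ?h \<xi>)"
      using D(3)[OF dom_y] by (auto simp: apply_y_def)
    have LyLx_int: "integrable lborel (\<lambda>y. apply_y L (apply_x L (cplx_kernel k)) x y)"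
      using D(2)[OF dom_y] by (simp add: apply_y_def)
    have h_int: "integrable lborel ?h"
      using lborel_integrable_affine[OF int_xy, of "-1" 0] by (simp add: mult_ac)
    have iexp_mult: "exp (\<i> * complex_of_real (y \<bullet> \<xi>)) * exp (\<i> * complex_of_real (\<xi> \<bullet> (- x))) =
        exp (\<i> * complex_of_real (\<xi> \<bullet> (y - x)))" for \<xi>
      by (simp add: exp_add[symmetric] inner_commute[of y] algebra_simps)
    have "integrable lborel (fourier (\<lambda>y. apply_y L (apply_x L (cplx_kernel k)) x y))"
      unfolding LyLx_fourier by (intro cexp h_int)
    from fourier_inversion[OF LyLx_int cont_y this, of y]
    have "apply_y L (apply_x L (cplx_kernel k)) x y = ?c * (\<integral>\<xi>. exp (\<i> * complex_of_real (y \<bullet> \<xi>)) *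
        (exp (\<i> * complex_of_real (\<xi> \<bullet> (- x))) * ?h \<xi>) \<partial>lborel)"
      unfolding LyLx_fourier .
    also have "(\<lambda>\<xi>. exp (\<i> * complex_of_real (y \<bullet> \<xi>)) * (exp (\<i> * complex_of_real (\<xi> \<bullet> (- x))) * ?h \<xi>)) =
        (\<lambda>\<xi>. exp (\<i> * complex_of_real (\<xi> \<bullet> (y - x))) * ?h \<xi>)"
      by (simp only: mult.assoc[symmetric] iexp_mult)
    \<comment> \<open>Under xi -> -xi the product m(xi) m(-xi) is invariant, while Khat(-xi) becomes
      Khat(xi) and the phase at y - x becomes the one at x - y. Measurability is taken from the
      integrable product, since \<open>m\<close> alone is not assumed measurable.\<close>
    also have "(\<integral>\<xi>. exp (\<i> * complex_of_real (\<xi> \<bullet> (y - x))) * ?h \<xi> \<partial>lborel) =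
        (\<integral>\<xi>. exp (\<i> * complex_of_real ((x - y) \<bullet> \<xi>)) * m \<xi> * m (- \<xi>) * Khat \<xi> \<partial>lborel)"
      using borel_measurable_integrable[OF cexp[OF h_int, of "y - x"]]
      by (subst lborel_integral_affine[where c = "-1" and t = 0])
         (simp_all add: inner_commute[of x] inner_commute[of y] inner_diff_left inner_diff_right mult_ac)
    finally show ?thesis .
  qed
  show ?thesis
    using Lx sym LyLx by blast
qed

end
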